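(* Let $\Gamma$ be a context, $r,s$ terms of Polymorphic System I and $A$ a type. If $\Gamma\vdash r:A$ and either $r\hookrightarrow s$ or $r\rightleftarrows s$, then $\Gamma\vdash s:A$.
   Context: Polymorphic System I (PSI). Types: $A ::= X \mid A\Rightarrow A \mid A\wedge A \mid \forall X.A$, with $X$ ranging over type variables; $FTV(A)$ is the set of free type variables; types and terms are taken modulo $\alpha$-equivalence; $\Rightarrow$ associates to the right. Type isomorphism $\equiv$ is the smallest congruence on types containing: $A\wedge B\equiv B\wedge A$; $A\wedge(B\wedge C)\equiv(A\wedge B)\wedge C$; $A\Rightarrow(B\wedge C)\equiv(A\Rightarrow B)\wedge(A\Rightarrow C)$; $(A\wedge B)\Rightarrow C\equiv A\Rightarrow B\Rightarrow C$; $\forall X.(A\Rightarrow B)\equiv A\Rightarrow\forall X.B$ if $X\notin FTV(A)$; $\forall X.(A\wedge B)\equiv\forall X.A\wedge\forall X.B$. Terms (Church style, variables carry types): $r ::= x^A \mid \lambda x^A.r \mid rr \mid \langle r,r\rangle \mid \pi_A(r) \mid \Lambda X.r \mid r[A]$. Typing rules: $\Gamma,x:A\vdash x:A$; from $\Gamma\vdash r:A$ and $A\equiv B$ infer $\Gamma\vdash r:B$; from $\Gamma,x:A\vdash r:B$ infer $\Gamma\vdash\lambda x^A.r:A\Rightarrow B$; from $\Gamma\vdash r:A\Rightarrow B$ and $\Gamma\vdash s:A$ infer $\Gamma\vdash rs:B$; from $\Gamma\vdash r:A$ and $\Gamma\vdash s:B$ infer $\Gamma\vdash\langle r,s\rangle:A\wedge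 B$; from $\Gamma\vdash r:A\wedge B$ infer $\Gamma\vdash\pi_A(r):A$; from $\Gamma\vdash r:A$ and $X\notin FTV(\Gamma)$ infer $\Gamma\vdash\Lambda X.r:\forall X.A$; from $\Gamma\vdash r:\forall X.A$ infer $\Gamma\vdash r[B]:[X:=B]A$. Term equivalence $\rightleftarrows$ is the symmetric relation, closed under all term constructors (if $r\rightleftarrows s$ then $\lambda x^A.r\rightleftarrows\lambda x^A.s$, $rt\rightleftarrows st$, $tr\rightleftarrows ts$, $\langle t,r\rangle\rightleftarrows\langle t,s\rangle$, $\langle r,t\rangle\rightleftarrows\langle s,t\rangle$, $\pi_A(r)\rightleftarrows\pi_A(s)$, $\Lambda X.r\rightleftarrows\Lambda X.s$, $r[A]\rightleftarrows s[A]$), generated by: $\langle r,s\rangle\rightleftarrows\langle s,r\rangle$; $\langle r,\langle s,t\rangle\rangle\rightleftarrows\langle\langle r,s\rangle,t\rangle$; $\lambda x^A.\langle r,s\rangle\rightleftarrows\langle\lambda x^A.r,\lambda x^A.s\rangle$; $\langle r,s\rangle t\rightleftarrows\langle rt,st\rangle$; $r\langle s,t\rangle\rightleftarrows (rs)t$; $\Lambda X.\lambda x^A.r\rightleftarrows\lambda x^A.\Lambda X.r$ if $X\notin FTV(A)$; $(\lambda x^A.r)[B]\rightleftarrows\lambda x^A.(r[B])$ (with side condition $X\notin FTV(A)$ as in the paper); $\Lambda X.\langle r,s\rangle\rightleftarrows\langle\Lambda X.r,\Lambda X.s\rangle$; $\langle r,s\rangle[A]\rightleftarrows\langle r[A],s[A]\rangle$;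 $\pi_{\forall X.A}(\Lambda X.r)\rightleftarrows\Lambda X.\pi_A(r)$; $(\pi_{\forall X.B}(r))[A]\rightleftarrows\pi_{[X:=A]B}(r[A])$ if $\Gamma\vdash r:\forall X.(B\wedge C)$. Reduction $\hookrightarrow$ is the closure under all term constructors of: $(\lambda x^A.r)s\hookrightarrow[x:=s]r$ if $\Gamma\vdash s:A$; $(\Lambda X.r)[A]\hookrightarrow[X:=A]r$; $\pi_A(\langle r,s\rangle)\hookrightarrow r$ if $\Gamma\vdash r:A$. *)

theory Defs
  imports Main
begin

text \<open>
  Types and terms modulo alpha-equivalence are represented with de Bruijn indices. Type variables
  and term variables are indexed independently: \<open>All\<close> and \<open>TLam\<close> bind type index 0, \<open>Lam\<close> binds
  term index 0. Free type variables are the indices beyond all enclosing binders.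
\<close>

datatype ty =
    TVar nat
  | Arr ty ty (infixr \<open>\<rightarrow>\<close> 65)
  | Conj ty ty (infixr \<open>\<otimes>\<close> 70)
  | All ty

primrec liftT :: "nat \<Rightarrow> ty \<Rightarrow> ty" where
  "liftT k (TVar i) = TVar (if i < k then i else Suc i)"
| "liftT k (A \<rightarrow> B) = liftT k A \<rightarrow> liftT k B"
| "liftT k (A \<otimes> B) = liftT k A \<otimes> liftT k B"
| "liftT k (All A) = All (liftT (Suc k) A)"

text \<open>
  \<open>substT k C A\<close> substitutes \<open>C\<close> for the variable \<open>k\<close> in \<open>A\<close> and removes that variable from the
  scope. Thus \<open>[X:=C]A\<close>, for \<open>X\<close> the variable bound in \<open>All A\<close>, is \<open>substT 0 C A\<close>.
\<close>

primrec substT :: "nat \<Rightarrow> ty \<Rightarrow> ty \<Rightarrow> ty" where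
  "substT k C (TVar i) = (if k < i then TVar (i - 1) else if i = k then C else TVar i)"
| "substT k C (A \<rightarrow> B) = substT k C A \<rightarrow> substT k C B"
| "substT k C (A \<otimes> B) = substT k C A \<otimes> substT k C B"
| "substT k C (All A) = All (substT (Suc k) (liftT 0 C) A)"

text \<open>
  A type under a binder of \<open>X\<close> satisfies \<open>X \<notin> FTV(A)\<close> iff it has the form \<open>liftT 0 A\<close>; the side
  conditions on free type variables are expressed in this way throughout.
\<close>

inductive tyiso :: "ty \<Rightarrow> ty \<Rightarrow> bool" (infix \<open>\<cong>\<close> 50) where
  iso_comm: "A \<otimes> B \<cong> B \<otimes> A"
| iso_assoc: "A \<otimes> (B \<otimes> C) \<cong> (A \<otimes> B) \<otimes> C"
| iso_dist: "A \<rightarrow> (B \<otimes> C) \<cong> (A \<rightarrow> B) \<otimes> (A \<rightarrow> C)"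
| iso_curry: "(A \<otimes> B) \<rightarrow> C \<cong> A \<rightarrow> B \<rightarrow> C"
| iso_all_arr: "All (liftT 0 A \<rightarrow> B) \<cong> A \<rightarrow> All B"
| iso_all_conj: "All (A \<otimes> B) \<cong> All A \<otimes> All B"
| iso_refl: "A \<cong> A"
| iso_sym: "A \<cong> B \<Longrightarrow> B \<cong> A"
| iso_trans: "A \<cong> B \<Longrightarrow> B \<cong> C \<Longrightarrow> A \<cong> C"
| iso_Arr: "A \<cong> A' \<Longrightarrow> B \<cong> B' \<Longrightarrow> A \<rightarrow> B \<cong> A' \<rightarrow> B'"
| iso_Conj: "A \<cong> A' \<Longrightarrow> B \<cong> B' \<Longrightarrow> A \<otimes> B \<cong> A' \<otimes> B'"
| iso_All: "A \<cong> B \<Longrightarrow> All A \<cong> All B"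

text \<open>Variable occurrences carry their type, as in \<open>x\<^sup>A\<close>.\<close>

datatype tm =
    Var nat ty
  | Lam ty tm
  | App tm tm
  | Pair tm tm
  | Proj ty tm
  | TLam tm
  | TApp tm ty

text \<open>
  \<open>lift\<close> and \<open>subst\<close> act on term variables, \<open>liftTm\<close> and \<open>substTm\<close> on the type variables
  occurring in a term (including those in the types carried by variables).
\<close>

primrec liftTm :: "nat \<Rightarrow> tm \<Rightarrow> tm" where
  "liftTm k (Var i A) = Var i (liftT k A)"
| "liftTm k (Lam A r) = Lam (liftT k A) (liftTm k r)"
| "liftTm k (App r s) = App (liftTm k r) (liftTm k s)"
| "liftTm k (Pair r s) = Pair (liftTm k r) (liftTm k s)"
| "liftTm k (Proj A r) = Proj (liftT k A) (liftTm k r)"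
| "liftTm k (TLam r) = TLam (liftTm (Suc k) r)"
| "liftTm k (TApp r A) = TApp (liftTm k r) (liftT k A)"

primrec substTm :: "nat \<Rightarrow> ty \<Rightarrow> tm \<Rightarrow> tm" where
  "substTm k C (Var i A) = Var i (substT k C A)"
| "substTm k C (Lam A r) = Lam (substT k C A) (substTm k C r)"
| "substTm k C (App r s) = App (substTm k C r) (substTm k C s)"
| "substTm k C (Pair r s) = Pair (substTm k C r) (substTm k C s)"
| "substTm k C (Proj A r) = Proj (substT k C A) (substTm k C r)"
| "substTm k C (TLam r) = TLam (substTm (Suc k) (liftT 0 C) r)"
| "substTm k C (TApp r A) = TApp (substTm k C r) (substT k C A)"

primrec lift :: "nat \<Rightarrow> tm \<Rightarrow> tm" where
  "lift k (Var i A) = Var (if i < k then i else Suc i) A"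
| "lift k (Lam A r) = Lam A (lift (Suc k) r)"
| "lift k (App r s) = App (lift k r) (lift k s)"
| "lift k (Pair r s) = Pair (lift k r) (lift k s)"
| "lift k (Proj A r) = Proj A (lift k r)"
| "lift k (TLam r) = TLam (lift k r)"
| "lift k (TApp r A) = TApp (lift k r) A"

primrec subst :: "nat \<Rightarrow> tm \<Rightarrow> tm \<Rightarrow> tm" where
  "subst k u (Var i A) = (if k < i then Var (i - 1) A else if i = k then u else Var i A)"
| "subst k u (Lam A r) = Lam A (subst (Suc k) (lift 0 u) r)"
| "subst k u (App r s) = App (subst k u r) (subst k u s)"
| "subst k u (Pair r s) = Pair (subst k u r) (subst k u s)"
| "subst k u (Proj A r) = Proj A (subst k u r)"
| "subst k u (TLam r) = TLam (subst k (liftTm 0 u) r)"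
| "subst k u (TApp r A) = TApp (subst k u r) A"

text \<open>
  A context lists the types of the term variables 0, 1, and so on. In \<open>ty_TLam\<close>, lifting the
  context expresses \<open>X \<notin> FTV(\<Gamma>)\<close>.
\<close>

inductive typing :: "ty list \<Rightarrow> tm \<Rightarrow> ty \<Rightarrow> bool" (\<open>_ \<turnstile> _ : _\<close> [50, 51, 51] 50) where
  ty_Var: "i < length \<Gamma> \<Longrightarrow> \<Gamma> ! i = A \<Longrightarrow> \<Gamma> \<turnstile> Var i A : A"
| ty_iso: "\<Gamma> \<turnstile> r : A \<Longrightarrow> A \<cong> B \<Longrightarrow> \<Gamma> \<turnstile> r : B"
| ty_Lam: "A # \<Gamma> \<turnstile> r : B \<Longrightarrow> \<Gamma> \<turnstile> Lam A r : A \<rightarrow> B"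
| ty_App: "\<Gamma> \<turnstile> r : A \<rightarrow> B \<Longrightarrow> \<Gamma> \<turnstile> s : A \<Longrightarrow> \<Gamma> \<turnstile> App r s : B"
| ty_Pair: "\<Gamma> \<turnstile> r : A \<Longrightarrow> \<Gamma> \<turnstile> s : B \<Longrightarrow> \<Gamma> \<turnstile> Pair r s : A \<otimes> B"
| ty_Proj: "\<Gamma> \<turnstile> r : A \<otimes> B \<Longrightarrow> \<Gamma> \<turnstile> Proj A r : A"
| ty_TLam: "map (liftT 0) \<Gamma> \<turnstile> r : A \<Longrightarrow> \<Gamma> \<turnstile> TLam r : All A"
| ty_TApp: "\<Gamma> \<turnstile> r : All A \<Longrightarrow> \<Gamma> \<turnstile> TApp r B : substT 0 B A"

text \<open>
  The typing premises of \<open>eqv_Proj_TApp\<close>, \<open>red_beta\<close> and \<open>red_pi\<close> ask for some context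
  \<open>\<Gamma>\<close>; neither relation is indexed by a context. As variables carry their types, any two
  contexts typing a term agree on its free variables.

  In \<open>eqv_TApp_Lam\<close> the side condition \<open>X \<notin> FTV(A)\<close> concerns the bound variable of the type
  \<open>\<forall>X.(A \<Rightarrow> B)\<close> of the abstraction. It holds up to alpha-equivalence and so leaves no trace here.
\<close>

inductive eqv :: "tm \<Rightarrow> tm \<Rightarrow> bool" (infix \<open>\<rightleftharpoons>\<close> 50) where
  eqv_comm: "Pair r s \<rightleftharpoons> Pair s r"
| eqv_assoc: "Pair r (Pair s t) \<rightleftharpoons> Pair (Pair r s) t"
| eqv_Lam_Pair: "Lam A (Pair r s) \<rightleftharpoons> Pair (Lam A r) (Lam A s)"
| eqv_App_Pair: "App (Pair r s) t \<rightleftharpoons> Pair (App r t) (App s t)"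
| eqv_curry: "App r (Pair s t) \<rightleftharpoons> App (App r s) t"
| eqv_TLam_Lam: "TLam (Lam (liftT 0 A) r) \<rightleftharpoons> Lam A (TLam r)"
| eqv_TApp_Lam: "TApp (Lam A r) B \<rightleftharpoons> Lam A (TApp r B)"
| eqv_TLam_Pair: "TLam (Pair r s) \<rightleftharpoons> Pair (TLam r) (TLam s)"
| eqv_TApp_Pair: "TApp (Pair r s) A \<rightleftharpoons> Pair (TApp r A) (TApp s A)"
| eqv_Proj_TLam: "Proj (All A) (TLam r) \<rightleftharpoons> TLam (Proj A r)"
| eqv_Proj_TApp: "\<Gamma> \<turnstile> r : All (B \<otimes> C) \<Longrightarrow>
    TApp (Proj (All B) r) A \<rightleftharpoons> Proj (substT 0 A B) (TApp r A)"
| eqv_sym: "r \<rightleftharpoons> s \<Longrightarrow> s \<rightleftharpoons> r"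
| eqv_Lam: "r \<rightleftharpoons> s \<Longrightarrow> Lam A r \<rightleftharpoons> Lam A s"
| eqv_App1: "r \<rightleftharpoons> s \<Longrightarrow> App r t \<rightleftharpoons> App s t"
| eqv_App2: "r \<rightleftharpoons> s \<Longrightarrow> App t r \<rightleftharpoons> App t s"
| eqv_Pair1: "r \<rightleftharpoons> s \<Longrightarrow> Pair r t \<rightleftharpoons> Pair s t"
| eqv_Pair2: "r \<rightleftharpoons> s \<Longrightarrow> Pair t r \<rightleftharpoons> Pair t s"
| eqv_Proj: "r \<rightleftharpoons> s \<Longrightarrow> Proj A r \<rightleftharpoons> Proj A s"
| eqv_TLam: "r \<rightleftharpoons> s \<Longrightarrow> TLam r \<rightleftharpoons> TLam s"
| eqv_TApp: "r \<rightleftharpoons> s \<Longrightarrow> TApp r A \<rightleftharpoons> TApp s A"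

inductive red :: "tm \<Rightarrow> tm \<Rightarrow> bool" (infix \<open>\<hookrightarrow>\<close> 50) where
  red_beta: "\<Gamma> \<turnstile> s : A \<Longrightarrow> App (Lam A r) s \<hookrightarrow> subst 0 s r"
| red_Beta: "TApp (TLam r) A \<hookrightarrow> substTm 0 A r"
| red_pi: "\<Gamma> \<turnstile> r : A \<Longrightarrow> Proj A (Pair r s) \<hookrightarrow> r"
| red_Lam: "r \<hookrightarrow> s \<Longrightarrow> Lam A r \<hookrightarrow> Lam A s"
| red_App1: "r \<hookrightarrow> s \<Longrightarrow> App r t \<hookrightarrow> App s t"
| red_App2: "r \<hookrightarrow> s \<Longrightarrow> App t r \<hookrightarrow> App t s"
| red_Pair1: "r \<hookrightarrow> s \<Longrightarrow> Pair r t \<hookrightarrow> Pair s t"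
| red_Pair2: "r \<hookrightarrow> s \<Longrightarrow> Pair t r \<hookrightarrow> Pair t s"
| red_Proj: "r \<hookrightarrow> s \<Longrightarrow> Proj A r \<hookrightarrow> Proj A s"
| red_TLam: "r \<hookrightarrow> s \<Longrightarrow> TLam r \<hookrightarrow> TLam s"
| red_TApp: "r \<hookrightarrow> s \<Longrightarrow> TApp r A \<hookrightarrow> TApp s A"

end

theory Submission
  imports Defs "HOL-Library.Multiset"
begin

text \<open>
  Oriented from left to right (with \<open>A \<rightarrow> \<forall>X.B\<close> becoming \<open>\<forall>X.(A \<rightarrow> B)\<close>), the isomorphisms turn every
  type into a conjunction of prime types \<open>\<forall>X\<^sub>1\<dots>X\<^sub>n. A\<^sub>1 \<rightarrow> \<dots> \<rightarrow> A\<^sub>m \<rightarrow> Y\<close> with prime \<open>A\<^sub>i\<close>, unique up to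
  the order of the conjuncts and of the \<open>A\<^sub>i\<close>. So types modulo isomorphism are multisets of primes,
  on which \<open>\<forall>\<close> and \<open>A \<rightarrow> _\<close> act elementwise and injectively. This shows which isomorphisms can hold
  between types with different head constructors, and that a term has at most one type up to
  isomorphism; both are what the rules of the two relations need.
\<close>

section \<open>De Bruijn lifting and substitution in types\<close>

lemma liftT_liftT: "i \<le> k \<Longrightarrow> liftT (Suc k) (liftT i A) = liftT i (liftT k A)"
  by (induction A arbitrary: i k) auto

lemma substT_liftT [simp]: "substT k C (liftT k A) = A"
  by (induction A arbitrary: k C) auto

lemma liftT_substT_le:
  "i \<le> k \<Longrightarrow> liftT i (substT k C A) = substT (Suc k) (liftT i C) (liftT i A)"
  by (induction A arbitrary: i k C) (auto simp: liftT_liftT)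

lemma liftT_substT_ge:
  "k \<le> i \<Longrightarrow> liftT i (substT k C A) = substT k (liftT i C) (liftT (Suc i) A)"
  by (induction A arbitrary: i k C) (auto simp: liftT_liftT)

text \<open>The substitution lemma in de Bruijn form. Its instance \<open>i = 0\<close> lets the
  instantiation of a quantifier commute with an outer substitution, as type application in
  \<open>typing_substTm\<close> requires.\<close>

lemma substT_substT:
  "i \<le> k \<Longrightarrow>
    substT k C (substT i D A) = substT i (substT k C D) (substT (Suc k) (liftT i C) A)"
  by (induction A arbitrary: i k C D) (auto simp: liftT_liftT liftT_substT_le)

lemma tyiso_liftT: "A \<cong> B \<Longrightarrow> liftT k A \<cong> liftT k B"
  by (induction arbitrary: k rule: tyiso.induct) (auto simp: liftT_liftT intro: tyiso.intros)

text \<open>The side condition of \<open>iso_all_arr\<close> survives because, by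
  \<open>liftT_substT_le\<close>, substituting under the binder into \<open>liftT 0 A\<close> again
  gives a lifted type.\<close>

lemma tyiso_substT: "A \<cong> B \<Longrightarrow> substT k C A \<cong> substT k C B"
proof (induction arbitrary: k C rule: tyiso.induct)
  case (iso_trans A B D)
  then show ?case by (blast intro: tyiso.iso_trans)
qed (auto simp: liftT_substT_le [symmetric] intro: tyiso.intros)

declare iso_trans [trans]


section \<open>Normal forms of types\<close>

text \<open>
  \<open>Prime n M y\<close> stands for \<open>\<forall>X\<^sub>1\<dots>X\<^sub>n. A\<^sub>1 \<rightarrow> \<dots> \<rightarrow> A\<^sub>m \<rightarrow> y\<close>, with \<open>M\<close> the multiset of the \<open>A\<^sub>i\<close>; the
  indices in \<open>M\<close> and \<open>y\<close> count the \<open>n\<close> quantifiers.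
\<close>

datatype prime = Prime nat "prime multiset" nat

primrec lift_prime :: "nat \<Rightarrow> prime \<Rightarrow> prime" where
  "lift_prime k (Prime n M y) =
    Prime n (image_mset (lift_prime (k + n)) M) (if y < k + n then y else Suc y)"

lemma lift_prime_lift_prime:
  "i \<le> k \<Longrightarrow> lift_prime (Suc k) (lift_prime i p) = lift_prime i (lift_prime k p)"
proof (induction p arbitrary: i k)
  case (Prime n M y)
  from Prime.prems have "i + n \<le> k + n" by simp
  with Prime.IH have "image_mset (lift_prime (Suc (k + n)) \<circ> lift_prime (i + n)) M =
      image_mset (lift_prime (i + n) \<circ> lift_prime (k + n)) M"
    by (intro image_mset_cong) auto
  with Prime.prems show ?case by (auto simp: image_mset.compositionality)
qed

lemma lift_prime_funpow:
  "lift_prime (k + n) ((lift_prime 0 ^^ n) p) = (lift_prime 0 ^^ n) (lift_prime k p)"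
  by (induction n) (simp_all add: lift_prime_lift_prime)

text \<open>In the scope of the new outermost quantifier, the indices in \<open>M\<close> and
  \<open>y\<close> already count it, so nothing is shifted.\<close>

primrec all_prime :: "prime \<Rightarrow> prime" where
  "all_prime (Prime n M y) = Prime (Suc n) M y"

text \<open>The domains \<open>K\<close> move inside the \<open>n\<close> quantifiers, as
  \<open>iso_all_arr\<close> allows, and are lifted once for each of them.\<close>

primrec arr_prime :: "prime multiset \<Rightarrow> prime \<Rightarrow> prime" where
  "arr_prime K (Prime n M y) = Prime n (M + image_mset (lift_prime 0 ^^ n) K) y"

primrec nf :: "ty \<Rightarrow> prime multiset" where
  "nf (TVar i) = {#Prime 0 {#} i#}"
| "nf (A \<rightarrow> B) = image_mset (arr_prime (nf A)) (nf B)"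
| "nf (A \<otimes> B) = nf A + nf B"
| "nf (All A) = image_mset all_prime (nf A)"

text \<open>There is no unit type. Nonemptiness is what allows a normal form to be read back as a
  conjunction.\<close>

lemma nf_nonempty [simp]: "nf A \<noteq> {#}"
  by (induction A) auto

lemma lift_prime_all: "lift_prime k (all_prime p) = all_prime (lift_prime (Suc k) p)"
  by (cases p) simp

lemma lift_prime_arr:
  "lift_prime k (arr_prime K p) = arr_prime (image_mset (lift_prime k) K) (lift_prime k p)"
  by (cases p) (simp add: image_mset.compositionality comp_def lift_prime_funpow)

lemma nf_liftT: "nf (liftT k A) = image_mset (lift_prime k) (nf A)"
  by (induction A arbitrary: k)
    (simp_all add: image_mset.compositionality comp_def lift_prime_all lift_prime_arr)

lemma arr_prime_plus: "arr_prime (K + L) = (\<lambda>p. arr_prime K (arr_prime L p))"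
proof
  fix p show "arr_prime (K + L) p = arr_prime K (arr_prime L p)"
    by (cases p) (simp add: ac_simps)
qed

text \<open>This is \<open>iso_all_arr\<close> on primes: one lift for the new quantifier followed
  by \<open>n\<close> lifts for those of \<open>p\<close> make the \<open>Suc n\<close> lifts on the
  right.\<close>

lemma all_prime_arr:
  "all_prime (arr_prime (image_mset (lift_prime 0) K) p) = arr_prime K (all_prime p)"
  by (cases p) (simp add: image_mset.compositionality funpow_Suc_right del: funpow.simps)

text \<open>Each generator becomes a multiset identity: union is commutative and associative, images
  distribute over it, \<open>arr_prime_plus\<close> gives currying and \<open>all_prime_arr\<close>
  the exchange of quantifier and arrow.\<close>

lemma nf_sound: "A \<cong> B \<Longrightarrow> nf A = nf B"
  by (induction rule: tyiso.induct)
    (simp_all add: image_mset.compositionality comp_def arr_prime_plus all_prime_arr nf_liftT ac_simps)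

lemma inj_all_prime: "inj all_prime"
proof (rule injI)
  fix p q assume "all_prime p = all_prime q"
  then show "p = q" by (cases p; cases q) simp
qed

text \<open>The quantifier count is kept, so equal images share it; then the same lifted domains are
  added on both sides and cancel.\<close>

lemma inj_arr_prime: "inj (arr_prime K)"
proof (rule injI)
  fix p q assume "arr_prime K p = arr_prime K q"
  then show "p = q" by (cases p; cases q) auto
qed

lemma inj_image_mset_eq: "inj f \<Longrightarrow> image_mset f M = image_mset f N \<Longrightarrow> M = N"
  by (metis multiset.inj_map injD)


section \<open>Reading back types from normal forms\<close>

text \<open>There is no empty conjunction: \<open>conj_list []\<close> is a junk value.\<close>

fun conj_list :: "ty list \<Rightarrow> ty" where
  "conj_list [] = TVar 0"
| "conj_list [A] = A"
| "conj_list (A # B # As) = A \<otimes> conj_list (B # As)"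

lemma conj_list_Cons: "As \<noteq> [] \<Longrightarrow> conj_list (A # As) = A \<otimes> conj_list As"
  by (cases As) auto

text \<open>Commutativity and associativity bubble \<open>A\<close> to the front. The remainder must
  be nonempty because an empty list has no meaningful conjunction.\<close>

lemma conj_list_remove1:
  "A \<in> set As \<Longrightarrow> remove1 A As \<noteq> [] \<Longrightarrow> conj_list As \<cong> A \<otimes> conj_list (remove1 A As)"
proof (induction As)
  case (Cons B As)
  show ?case
  proof (cases "B = A")
    case True
    with Cons.prems show ?thesis by (simp add: conj_list_Cons iso_refl)
  next
    case False
    with Cons.prems have A: "A \<in> set As" by auto
    then have ne: "As \<noteq> []" by auto
    show ?thesis
    proof (cases "remove1 A As = []")
      case True
      \<comment> \<open>Only \<open>B\<close> and \<open>A\<close> are left, and one swap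
        suffices.\<close>
      with A have "As = [A]" by (cases As) (auto split: if_splits)
      with False show ?thesis by (simp add: iso_comm)
    next
      case rest: False
      have "conj_list (B # As) \<cong> B \<otimes> (A \<otimes> conj_list (remove1 A As))"
        using Cons.IH [OF A rest] ne by (simp add: conj_list_Cons iso_Conj iso_refl)
      also have "\<dots> \<cong> (B \<otimes> A) \<otimes> conj_list (remove1 A As)" by (rule iso_assoc)
      also have "\<dots> \<cong> (A \<otimes> B) \<otimes> conj_list (remove1 A As)"
        by (intro iso_Conj iso_comm iso_refl)
      also have "\<dots> \<cong> A \<otimes> (B \<otimes> conj_list (remove1 A As))" by (rule iso_sym [OF iso_assoc])
      finally show ?thesis using False rest by (simp add: conj_list_Cons)
    qed
  qed
qed simp

lemma conj_list_perm: "mset As = mset Bs \<Longrightarrow> conj_list As \<cong> conj_list Bs"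
proof (induction As arbitrary: Bs)
  case Nil
  then show ?case by (simp add: iso_refl)
next
  case (Cons A As)
  then have A: "A \<in> set Bs" by (metis list.set_intros(1) set_mset_mset)
  have m: "mset As = mset (remove1 A Bs)"
    using Cons.prems by (simp flip: Cons.prems)
  show ?case
  proof (cases "As = []")
    case True
    with Cons.prems have "Bs = [A]" by simp
    with True show ?thesis by (simp add: iso_refl)
  next
    case False
    with m have ne: "remove1 A Bs \<noteq> []" by (metis mset_zero_iff)
    have "conj_list (A # As) \<cong> A \<otimes> conj_list (remove1 A Bs)"
      using Cons.IH [OF m] False by (simp add: conj_list_Cons iso_Conj iso_refl)
    also have "\<dots> \<cong> conj_list Bs" by (rule iso_sym [OF conj_list_remove1 [OF A ne]])
    finally show ?thesis .
  qed
qed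

text \<open>An arbitrary enumeration is chosen. By \<open>conj_list_perm\<close> the choice matters
  only up to isomorphism, so the laws that follow are isomorphisms and not equations.\<close>

definition conj_mset :: "ty multiset \<Rightarrow> ty" where
  "conj_mset M = conj_list (SOME As. mset As = M)"

lemma conj_mset_mset: "conj_mset (mset As) \<cong> conj_list As"
  unfolding conj_mset_def by (rule conj_list_perm) (rule someI_ex, blast)

lemma conj_mset_single: "conj_mset {#A#} \<cong> A"
  using conj_mset_mset [of "[A]"] by simp

lemma conj_mset_add:
  assumes "M \<noteq> {#}"
  shows "conj_mset (add_mset A M) \<cong> A \<otimes> conj_mset M"
proof -
  obtain As where As: "M = mset As" by (metis ex_mset)
  with assms have "As \<noteq> []" by auto
  with As conj_mset_mset [of "A # As"] have "conj_mset (add_mset A M) \<cong> A \<otimes> conj_list As"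
    by (simp add: conj_list_Cons)
  also have "\<dots> \<cong> A \<otimes> conj_mset M"
    unfolding As by (intro iso_Conj iso_refl iso_sym [OF conj_mset_mset])
  finally show ?thesis .
qed

section \<open>Iterated arrows over a multiset of domains\<close>

definition arr_mset :: "ty multiset \<Rightarrow> ty \<Rightarrow> ty" where
  "arr_mset M B = foldr Arr (SOME As. mset As = M) B"

text \<open>Adjacent domains are exchanged by uncurrying, swapping the conjunction and currying
  again.\<close>

lemma foldr_Arr_remove1: "A \<in> set As \<Longrightarrow> foldr Arr As B \<cong> A \<rightarrow> foldr Arr (remove1 A As) B"
proof (induction As)
  case (Cons C As)
  show ?case
  proof (cases "C = A")
    case True
    then show ?thesis by (simp add: iso_refl)
  next
    case False
    let ?R = "foldr Arr (remove1 A As) B"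
    have "C \<rightarrow> foldr Arr As B \<cong> C \<rightarrow> A \<rightarrow> ?R"
      using Cons False by (auto intro: iso_Arr iso_refl)
    also have "\<dots> \<cong> (C \<otimes> A) \<rightarrow> ?R" by (rule iso_sym [OF iso_curry])
    also have "\<dots> \<cong> (A \<otimes> C) \<rightarrow> ?R" by (intro iso_Arr iso_comm iso_refl)
    also have "\<dots> \<cong> A \<rightarrow> C \<rightarrow> ?R" by (rule iso_curry)
    finally show ?thesis using False by simp
  qed
qed simp

lemma foldr_Arr_perm: "mset As = mset Bs \<Longrightarrow> foldr Arr As C \<cong> foldr Arr Bs C"
proof (induction As arbitrary: Bs)
  case Nil
  then show ?case by (simp add: iso_refl)
next
  case (Cons A As)
  then have A: "A \<in> set Bs" by (metis list.set_intros(1) set_mset_mset)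
  have m: "mset As = mset (remove1 A Bs)"
    using Cons.prems by (simp flip: Cons.prems)
  have "foldr Arr (A # As) C \<cong> A \<rightarrow> foldr Arr (remove1 A Bs) C"
    using Cons.IH [OF m] by (simp add: iso_Arr iso_refl)
  also have "\<dots> \<cong> foldr Arr Bs C" by (rule iso_sym [OF foldr_Arr_remove1 [OF A]])
  finally show ?case .
qed

lemma arr_mset_mset: "arr_mset (mset As) B \<cong> foldr Arr As B"
  unfolding arr_mset_def by (rule foldr_Arr_perm) (rule someI_ex, blast)

lemma arr_mset_empty [simp]: "arr_mset {#} B = B"
  by (simp add: arr_mset_def)

lemma arr_mset_add: "arr_mset (add_mset A M) B \<cong> A \<rightarrow> arr_mset M B"
proof -
  obtain As where As: "M = mset As" by (metis ex_mset)
  with arr_mset_mset [of "A # As"] have "arr_mset (add_mset A M) B \<cong> A \<rightarrow> foldr Arr As B"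
    by simp
  also have "\<dots> \<cong> A \<rightarrow> arr_mset M B"
    unfolding As by (intro iso_Arr iso_refl iso_sym [OF arr_mset_mset])
  finally show ?thesis .
qed

section \<open>Congruence, union, currying and lifting for multiset conjunctions and arrows\<close>

lemma conj_mset_cong:
  assumes "M \<noteq> {#}" and "\<And>x. x \<in># M \<Longrightarrow> f x \<cong> g x"
  shows "conj_mset (image_mset f M) \<cong> conj_mset (image_mset g M)"
  using assms
proof (induction M)
  case (add x M)
  have x: "f x \<cong> g x" using add.prems by simp
  show ?case
  proof (cases "M = {#}")
    case True
    with x show ?thesis
      by (auto intro: iso_trans [OF conj_mset_single iso_trans [OF x iso_sym [OF conj_mset_single]]])
  next
    case False
    then have "conj_mset (image_mset f (add_mset x M)) \<cong> f x \<otimes> conj_mset (image_mset f M)"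
      by (simp add: conj_mset_add)
    also have "\<dots> \<cong> g x \<otimes> conj_mset (image_mset g M)"
      using add False by (auto intro!: iso_Conj)
    also have "\<dots> \<cong> conj_mset (image_mset g (add_mset x M))"
      using False by (simp add: conj_mset_add iso_sym)
    finally show ?thesis .
  qed
qed simp

lemma conj_mset_plus:
  assumes "M \<noteq> {#}" and "N \<noteq> {#}"
  shows "conj_mset (M + N) \<cong> conj_mset M \<otimes> conj_mset N"
  using assms(1)
proof (induction M)
  case (add A M)
  show ?case
  proof (cases "M = {#}")
    case True
    have "conj_mset (add_mset A N) \<cong> A \<otimes> conj_mset N" using assms(2) by (rule conj_mset_add)
    also have "\<dots> \<cong> conj_mset {#A#} \<otimes> conj_mset N"
      by (intro iso_Conj iso_refl iso_sym [OF conj_mset_single])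
    finally show ?thesis using True by simp
  next
    case False
    then have "conj_mset (add_mset A M + N) \<cong> A \<otimes> conj_mset (M + N)"
      by (simp add: conj_mset_add)
    also have "\<dots> \<cong> A \<otimes> (conj_mset M \<otimes> conj_mset N)"
      using add.IH [OF False] by (intro iso_Conj iso_refl)
    also have "\<dots> \<cong> (A \<otimes> conj_mset M) \<otimes> conj_mset N" by (rule iso_assoc)
    also have "\<dots> \<cong> conj_mset (add_mset A M) \<otimes> conj_mset N"
      using False by (intro iso_Conj iso_refl iso_sym [OF conj_mset_add])
    finally show ?thesis .
  qed
qed simp

text \<open>The assumption ranges over members of \<open>M\<close> only, to match the induction
  hypothesis in \<open>read_lift_prime\<close>.\<close>

lemma arr_mset_cong:
  "(\<And>x. x \<in># M \<Longrightarrow> f x \<cong> g x) \<Longrightarrow> arr_mset (image_mset f M) B \<cong> arr_mset (image_mset g M) B"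
proof (induction M)
  case (add x M)
  have "arr_mset (image_mset f (add_mset x M)) B \<cong> f x \<rightarrow> arr_mset (image_mset f M) B"
    by (simp add: arr_mset_add)
  also have "\<dots> \<cong> g x \<rightarrow> arr_mset (image_mset g M) B"
    using add by (auto intro!: iso_Arr)
  also have "\<dots> \<cong> arr_mset (image_mset g (add_mset x M)) B"
    by (simp add: arr_mset_add iso_sym)
  finally show ?case .
qed (simp add: iso_refl)

lemma conj_mset_Arr:
  assumes "K \<noteq> {#}"
  shows "conj_mset K \<rightarrow> arr_mset M B \<cong> arr_mset (M + K) B"
  using assms
proof (induction K)
  case (add A K)
  show ?case
  proof (cases "K = {#}")
    case True
    have "conj_mset {#A#} \<rightarrow> arr_mset M B \<cong> A \<rightarrow> arr_mset M B"
      by (intro iso_Arr conj_mset_single iso_refl)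
    also have "\<dots> \<cong> arr_mset (add_mset A M) B" by (rule iso_sym [OF arr_mset_add])
    finally show ?thesis using True by simp
  next
    case False
    have "conj_mset (add_mset A K) \<rightarrow> arr_mset M B \<cong> (A \<otimes> conj_mset K) \<rightarrow> arr_mset M B"
      using False by (intro iso_Arr conj_mset_add iso_refl)
    also have "\<dots> \<cong> A \<rightarrow> conj_mset K \<rightarrow> arr_mset M B" by (rule iso_curry)
    also have "\<dots> \<cong> A \<rightarrow> arr_mset (M + K) B"
      using add.IH [OF False] by (intro iso_Arr iso_refl)
    also have "\<dots> \<cong> arr_mset (add_mset A (M + K)) B" by (rule iso_sym [OF arr_mset_add])
    finally show ?thesis by simp
  qed
qed simp

text \<open>This holds only up to isomorphism: the lifted enumeration of \<open>M\<close> need not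
  be the one chosen for the lifted multiset.\<close>

lemma liftT_conj_mset:
  assumes "M \<noteq> {#}"
  shows "liftT k (conj_mset M) \<cong> conj_mset (image_mset (liftT k) M)"
  using assms
proof (induction M)
  case (add A M)
  show ?case
  proof (cases "M = {#}")
    case True
    have "liftT k (conj_mset {#A#}) \<cong> liftT k A" by (rule tyiso_liftT [OF conj_mset_single])
    also have "\<dots> \<cong> conj_mset {#liftT k A#}" by (rule iso_sym [OF conj_mset_single])
    finally show ?thesis using True by simp
  next
    case False
    have "liftT k (conj_mset (add_mset A M)) \<cong> liftT k (A \<otimes> conj_mset M)"
      by (rule tyiso_liftT [OF conj_mset_add [OF False]])
    also have "\<dots> \<cong> liftT k A \<otimes> conj_mset (image_mset (liftT k) M)"
      using add.IH [OF False] by (auto intro: iso_Conj iso_refl)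
    also have "\<dots> \<cong> conj_mset (image_mset (liftT k) (add_mset A M))"
      using False by (simp add: conj_mset_add iso_sym)
    finally show ?thesis .
  qed
qed simp

lemma liftT_arr_mset: "liftT k (arr_mset M B) \<cong> arr_mset (image_mset (liftT k) M) (liftT k B)"
proof (induction M)
  case (add A M)
  have "liftT k (arr_mset (add_mset A M) B) \<cong> liftT k (A \<rightarrow> arr_mset M B)"
    by (rule tyiso_liftT [OF arr_mset_add])
  also have "\<dots> \<cong> liftT k A \<rightarrow> arr_mset (image_mset (liftT k) M) (liftT k B)"
    using add.IH by (auto intro: iso_Arr iso_refl)
  also have "\<dots> \<cong> arr_mset (image_mset (liftT k) (add_mset A M)) (liftT k B)"
    by (simp add: arr_mset_add iso_sym)
  finally show ?case .
qed (simp add: iso_refl)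

section \<open>Blocks of quantifiers\<close>

lemma funpow_All_cong: "A \<cong> B \<Longrightarrow> (All ^^ n) A \<cong> (All ^^ n) B"
  by (induction n) (auto intro: iso_All)

lemma liftT_funpow_All: "liftT k ((All ^^ n) A) = (All ^^ n) (liftT (k + n) A)"
  by (induction n arbitrary: k) auto

text \<open>The induction generalises \<open>A\<close>, since each quantifier crossed lifts it
  once.\<close>

lemma Arr_funpow_All: "A \<rightarrow> (All ^^ n) B \<cong> (All ^^ n) ((liftT 0 ^^ n) A \<rightarrow> B)"
proof (induction n arbitrary: A)
  case (Suc n)
  have "A \<rightarrow> All ((All ^^ n) B) \<cong> All (liftT 0 A \<rightarrow> (All ^^ n) B)"
    by (rule iso_sym [OF iso_all_arr])
  also have "\<dots> \<cong> All ((All ^^ n) ((liftT 0 ^^ n) (liftT 0 A) \<rightarrow> B))"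
    by (rule iso_All [OF Suc.IH])
  finally show ?case by (simp add: funpow_swap1)
qed (simp add: iso_refl)

section \<open>The reading map, inverse to \<open>nf\<close> up to isomorphism\<close>

primrec read_prime :: "prime \<Rightarrow> ty" where
  "read_prime (Prime n M y) = (All ^^ n) (arr_mset (image_mset read_prime M) (TVar y))"

definition read :: "prime multiset \<Rightarrow> ty" where
  "read M = conj_mset (image_mset read_prime M)"

lemma read_lift_prime: "read_prime (lift_prime k p) \<cong> liftT k (read_prime p)"
proof (induction p arbitrary: k)
  case (Prime n M y)
  let ?y = "if y < k + n then y else Suc y"
  \<comment> \<open>Under the \<open>n\<close> quantifiers the cutoff is \<open>k + n\<close>, where
    the induction hypothesis is used.\<close>
  have "arr_mset (image_mset (\<lambda>p. read_prime (lift_prime (k + n) p)) M) (TVar ?y)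
      \<cong> arr_mset (image_mset (\<lambda>p. liftT (k + n) (read_prime p)) M) (TVar ?y)"
    using Prime.IH by (rule arr_mset_cong)
  also have "\<dots> \<cong> liftT (k + n) (arr_mset (image_mset read_prime M) (TVar y))"
    using iso_sym [OF liftT_arr_mset [of "k + n" "image_mset read_prime M" "TVar y"]]
    by (simp add: image_mset.compositionality comp_def)
  finally show ?case
    unfolding read_prime.simps lift_prime.simps liftT_funpow_All
    by (intro funpow_All_cong) (simp add: image_mset.compositionality comp_def)
qed

lemma read_funpow_lift_prime:
  "read_prime ((lift_prime 0 ^^ n) p) \<cong> (liftT 0 ^^ n) (read_prime p)"
  by (induction n) (auto intro: iso_refl iso_trans [OF read_lift_prime tyiso_liftT])

lemma funpow_liftT_conj_mset:
  "M \<noteq> {#} \<Longrightarrow> (liftT 0 ^^ n) (conj_mset M) \<cong> conj_mset (image_mset (liftT 0 ^^ n) M)"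
proof (induction n)
  case (Suc n)
  have "liftT 0 ((liftT 0 ^^ n) (conj_mset M)) \<cong> liftT 0 (conj_mset (image_mset (liftT 0 ^^ n) M))"
    using Suc by (intro tyiso_liftT) blast
  also have "\<dots> \<cong> conj_mset (image_mset (liftT 0) (image_mset (liftT 0 ^^ n) M))"
    using Suc.prems by (intro liftT_conj_mset) simp
  finally show ?case by (simp add: image_mset.compositionality comp_def)
qed (simp add: iso_refl)

text \<open>The arrow is pushed under the \<open>n\<close> quantifiers of \<open>p\<close>, and the
  conjunction \<open>read K\<close> is then curried into its conjuncts, which join the domains in
  \<open>M\<close>.\<close>

lemma read_arr_prime:
  assumes "K \<noteq> {#}"
  shows "read K \<rightarrow> read_prime p \<cong> read_prime (arr_prime K p)"
proof (cases p)
  case (Prime n M y)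
  let ?M = "image_mset read_prime M"
  let ?K = "image_mset (\<lambda>q. read_prime ((lift_prime 0 ^^ n) q)) K"
  have "(liftT 0 ^^ n) (read K) \<cong> conj_mset (image_mset (liftT 0 ^^ n) (image_mset read_prime K))"
    unfolding read_def using assms by (intro funpow_liftT_conj_mset) simp
  also have "\<dots> \<cong> conj_mset ?K"
    unfolding image_mset.compositionality comp_def
    by (intro conj_mset_cong assms iso_sym [OF read_funpow_lift_prime])
  finally have K: "(liftT 0 ^^ n) (read K) \<cong> conj_mset ?K" .
  have "read K \<rightarrow> read_prime p \<cong> (All ^^ n) ((liftT 0 ^^ n) (read K) \<rightarrow> arr_mset ?M (TVar y))"
    unfolding Prime read_prime.simps by (rule Arr_funpow_All)
  also have "\<dots> \<cong> (All ^^ n) (conj_mset ?K \<rightarrow> arr_mset ?M (TVar y))"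
    by (intro funpow_All_cong iso_Arr K iso_refl)
  also have "\<dots> \<cong> (All ^^ n) (arr_mset (?M + ?K) (TVar y))"
    using assms by (intro funpow_All_cong conj_mset_Arr) simp
  finally show ?thesis
    by (simp add: Prime image_mset.compositionality comp_def)
qed

lemma Arr_conj_mset:
  assumes "M \<noteq> {#}"
  shows "A \<rightarrow> conj_mset M \<cong> conj_mset (image_mset (Arr A) M)"
  using assms
proof (induction M)
  case (add B M)
  show ?case
  proof (cases "M = {#}")
    case True
    have "A \<rightarrow> conj_mset {#B#} \<cong> A \<rightarrow> B" by (intro iso_Arr iso_refl conj_mset_single)
    also have "\<dots> \<cong> conj_mset {#A \<rightarrow> B#}" by (rule iso_sym [OF conj_mset_single])
    finally show ?thesis using True by simp
  next
    case False
    have "A \<rightarrow> conj_mset (add_mset B M) \<cong> A \<rightarrow> (B \<otimes> conj_mset M)"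
      by (intro iso_Arr iso_refl conj_mset_add False)
    also have "\<dots> \<cong> (A \<rightarrow> B) \<otimes> (A \<rightarrow> conj_mset M)" by (rule iso_dist)
    also have "\<dots> \<cong> (A \<rightarrow> B) \<otimes> conj_mset (image_mset (Arr A) M)"
      by (intro iso_Conj iso_refl add.IH False)
    also have "\<dots> \<cong> conj_mset (image_mset (Arr A) (add_mset B M))"
      using False by (simp add: conj_mset_add iso_sym)
    finally show ?thesis .
  qed
qed simp

lemma All_conj_mset:
  assumes "M \<noteq> {#}"
  shows "All (conj_mset M) \<cong> conj_mset (image_mset All M)"
  using assms
proof (induction M)
  case (add B M)
  show ?case
  proof (cases "M = {#}")
    case True
    have "All (conj_mset {#B#}) \<cong> All B" by (intro iso_All conj_mset_single)
    also have "\<dots> \<cong> conj_mset {#All B#}" by (rule iso_sym [OF conj_mset_single])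
    finally show ?thesis using True by simp
  next
    case False
    have "All (conj_mset (add_mset B M)) \<cong> All (B \<otimes> conj_mset M)"
      by (intro iso_All conj_mset_add False)
    also have "\<dots> \<cong> All B \<otimes> All (conj_mset M)" by (rule iso_all_conj)
    also have "\<dots> \<cong> All B \<otimes> conj_mset (image_mset All M)"
      by (intro iso_Conj iso_refl add.IH False)
    also have "\<dots> \<cong> conj_mset (image_mset All (add_mset B M))"
      using False by (simp add: conj_mset_add iso_sym)
    finally show ?thesis .
  qed
qed simp

text \<open>Each clause of \<open>nf\<close> is matched by an isomorphism: arrows and quantifiers
  distribute over the conjunction and are then absorbed by the single primes.\<close>

lemma read_nf: "A \<cong> read (nf A)"
proof (induction A)
  case (TVar i)
  show ?case
    using iso_sym [OF conj_mset_single [of "TVar i"]] by (simp add: read_def)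
next
  case (Arr A B)
  have "A \<rightarrow> B \<cong> read (nf A) \<rightarrow> read (nf B)" by (intro iso_Arr Arr)
  also have "\<dots> \<cong> conj_mset (image_mset (\<lambda>p. read (nf A) \<rightarrow> read_prime p) (nf B))"
    using Arr_conj_mset [of "image_mset read_prime (nf B)"]
    by (simp add: read_def image_mset.compositionality comp_def)
  also have "\<dots> \<cong> conj_mset (image_mset (\<lambda>p. read_prime (arr_prime (nf A) p)) (nf B))"
    by (intro conj_mset_cong read_arr_prime) simp_all
  finally show ?case by (simp add: read_def image_mset.compositionality comp_def)
next
  case (Conj A B)
  have "A \<otimes> B \<cong> read (nf A) \<otimes> read (nf B)" by (intro iso_Conj Conj)
  also have "\<dots> \<cong> read (nf (A \<otimes> B))"
    by (simp add: read_def conj_mset_plus iso_sym)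
  finally show ?case .
next
  case (All A)
  have "All A \<cong> All (read (nf A))" by (rule iso_All [OF All])
  also have "\<dots> \<cong> conj_mset (image_mset (\<lambda>p. All (read_prime p)) (nf A))"
    using All_conj_mset [of "image_mset read_prime (nf A)"]
    by (simp add: read_def image_mset.compositionality comp_def)
  \<comment> \<open>An equality of functions: \<open>all_prime\<close> only increases the number of
    leading quantifiers.\<close>
  also have "(\<lambda>p. All (read_prime p)) = (\<lambda>p. read_prime (all_prime p))"
  proof
    fix p show "All (read_prime p) = read_prime (all_prime p)" by (cases p) simp
  qed
  finally show ?case by (simp add: read_def image_mset.compositionality comp_def)
qed

text \<open>Completeness holds because types with equal normal forms are isomorphic to the same type
  read back from them.\<close>

lemma tyiso_iff_nf: "A \<cong> B \<longleftrightarrow> nf A = nf B"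
  by (metis iso_sym iso_trans nf_sound read_nf)

lemma nf_conj_mset: "M \<noteq> {#} \<Longrightarrow> nf (conj_mset M) = sum_mset (image_mset nf M)"
proof (induction M)
  case (add A M)
  then show ?case
    by (cases "M = {#}")
      (simp_all add: nf_sound [OF conj_mset_single] nf_sound [OF conj_mset_add])
qed simp

lemma nf_arr_mset: "nf (arr_mset M (TVar y)) = {#Prime 0 (sum_mset (image_mset nf M)) y#}"
  by (induction M) (simp_all add: nf_sound [OF arr_mset_add] ac_simps)

lemma nf_funpow_All: "nf ((All ^^ n) A) = image_mset (all_prime ^^ n) (nf A)"
  by (induction n) (simp_all add: image_mset.compositionality comp_def)

lemma funpow_all_prime: "(all_prime ^^ n) (Prime m M y) = Prime (n + m) M y"
  by (induction n) simp_all

lemma nf_read_prime: "nf (read_prime p) = {#p#}"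
proof (induction p)
  case (Prime n M y)
  then have "image_mset (\<lambda>q. nf (read_prime q)) M = image_mset (\<lambda>q. {#q#}) M"
    by (intro image_mset_cong)
  then show ?case
    by (simp add: nf_funpow_All nf_arr_mset funpow_all_prime image_mset.compositionality comp_def)
qed

text \<open>Every nonempty multiset of primes is thus the normal form of a type, which supplies the
  witnesses in the inversion lemmas.\<close>

lemma nf_read: "M \<noteq> {#} \<Longrightarrow> nf (read M) = M"
  by (simp add: read_def nf_conj_mset image_mset.compositionality comp_def nf_read_prime)


section \<open>Inversion of type isomorphisms\<close>

lemma All_iso_All: "All A \<cong> All B \<longleftrightarrow> A \<cong> B"
  by (auto simp: tyiso_iff_nf dest: inj_image_mset_eq [OF inj_all_prime])

text \<open>The domains must be known to agree, since
  \<open>A \<rightarrow> B \<rightarrow> C\<close> and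
  \<open>B \<rightarrow> A \<rightarrow> C\<close> are isomorphic.\<close>

lemma Arr_iso_Arr_cancel: "A \<rightarrow> B \<cong> A' \<rightarrow> B' \<Longrightarrow> A \<cong> A' \<Longrightarrow> B \<cong> B'"
  by (auto simp: tyiso_iff_nf dest: inj_image_mset_eq [OF inj_arr_prime])

lemma Conj_iso_Arr:
  assumes "R \<otimes> S \<cong> A \<rightarrow> D"
  obtains D1 D2 where "R \<cong> A \<rightarrow> D1" "S \<cong> A \<rightarrow> D2" "D \<cong> D1 \<otimes> D2"
proof -
  from assms have "image_mset (arr_prime (nf A)) (nf D) = nf R + nf S"
    by (simp add: tyiso_iff_nf)
  \<comment> \<open>A splitting of an image multiset comes from a splitting of its source.\<close>
  then obtain X Y where XY: "nf D = X + Y"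
      "nf R = image_mset (arr_prime (nf A)) X" "nf S = image_mset (arr_prime (nf A)) Y"
    by (metis image_mset_eq_plusD)
  \<comment> \<open>\<open>R\<close> and \<open>S\<close> have nonempty normal forms, hence so are
    the preimages, and both can be read back as types.\<close>
  then have "X \<noteq> {#}" "Y \<noteq> {#}" by (metis image_mset_empty nf_nonempty)+
  with XY show thesis
    by (intro that [of "read X" "read Y"]) (simp_all add: tyiso_iff_nf nf_read)
qed

lemma Conj_iso_All:
  assumes "R \<otimes> S \<cong> All D"
  obtains D1 D2 where "R \<cong> All D1" "S \<cong> All D2" "D \<cong> D1 \<otimes> D2"
proof -
  from assms have "image_mset all_prime (nf D) = nf R + nf S"
    by (simp add: tyiso_iff_nf)
  then obtain X Y where XY: "nf D = X + Y"
      "nf R = image_mset all_prime X" "nf S = image_mset all_prime Y"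
    by (metis image_mset_eq_plusD)
  then have "X \<noteq> {#}" "Y \<noteq> {#}" by (metis image_mset_empty nf_nonempty)+
  with XY show thesis
    by (intro that [of "read X" "read Y"]) (simp_all add: tyiso_iff_nf nf_read)
qed

text \<open>Adding domains keeps the number of quantifiers, so \<open>p\<close> has at least the one
  that \<open>all_prime\<close> contributes.\<close>

lemma arr_prime_eq_all_prime: "arr_prime K p = all_prime q \<Longrightarrow> p \<in> range all_prime"
proof (cases p; cases q)
  fix n M y n' M' y'
  assume "arr_prime K p = all_prime q" and p: "p = Prime n M y" and "q = Prime n' M' y'"
  then have "p = all_prime (Prime n' M y)" by simp
  then show ?thesis by blast
qed

lemma Arr_iso_All:
  assumes "A \<rightarrow> R \<cong> All C"
  obtains R' where "R \<cong> All R'" "C \<cong> liftT 0 A \<rightarrow> R'"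
proof -
  from assms have *: "image_mset (arr_prime (nf A)) (nf R) = image_mset all_prime (nf C)"
    by (simp add: tyiso_iff_nf)
  have "p \<in> range all_prime" if "p \<in># nf R" for p
  proof -
    from that have "arr_prime (nf A) p \<in># image_mset (arr_prime (nf A)) (nf R)" by simp
    then show ?thesis unfolding * by (auto intro: arr_prime_eq_all_prime)
  qed
  \<comment> \<open>All primes of \<open>R\<close> being quantified, stripping their first
    quantifier yields the body \<open>R'\<close>.\<close>
  then have "image_mset (all_prime \<circ> inv all_prime) (nf R) = image_mset id (nf R)"
    by (intro image_mset_cong) (simp add: f_inv_into_f)
  then have R: "R \<cong> All (read (image_mset (inv all_prime) (nf R)))" (is "_ \<cong> All ?R")
    by (simp add: tyiso_iff_nf nf_read image_mset.compositionality)
  \<comment> \<open>Both \<open>C\<close> and \<open>liftT 0 A \<rightarrow> ?R\<close> become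
    isomorphic after quantification, so \<open>All_iso_All\<close> compares them.\<close>
  have "All (liftT 0 A \<rightarrow> ?R) \<cong> A \<rightarrow> All ?R" by (rule iso_all_arr)
  also have "\<dots> \<cong> A \<rightarrow> R" by (intro iso_Arr iso_refl iso_sym [OF R])
  also have "\<dots> \<cong> All C" by (rule assms)
  finally have "C \<cong> liftT 0 A \<rightarrow> ?R" by (auto simp: All_iso_All intro: iso_sym)
  with R show thesis by (rule that)
qed


section \<open>Generation and uniqueness of types\<close>

text \<open>The rule \<open>ty_iso\<close> applies to every term, so generation holds up to an
  isomorphism, composed by transitivity along the derivation.\<close>

lemma typing_VarD: "\<Gamma> \<turnstile> Var i A : B \<Longrightarrow> i < length \<Gamma> \<and> \<Gamma> ! i = A \<and> A \<cong> B"
  by (induction \<Gamma> "Var i A" B rule: typing.induct) (meson iso_refl iso_trans)+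

lemma typing_LamD: "\<Gamma> \<turnstile> Lam A r : D \<Longrightarrow> \<exists>B. A # \<Gamma> \<turnstile> r : B \<and> A \<rightarrow> B \<cong> D"
  by (induction \<Gamma> "Lam A r" D rule: typing.induct) (meson iso_refl iso_trans)+

text \<open>A conversion after the application is pushed into the codomain of the type of
  \<open>r\<close>, so no isomorphism remains in the conclusion.\<close>

lemma typing_AppD: "\<Gamma> \<turnstile> App r s : D \<Longrightarrow> \<exists>A. \<Gamma> \<turnstile> r : A \<rightarrow> D \<and> \<Gamma> \<turnstile> s : A"
  by (induction \<Gamma> "App r s" D rule: typing.induct) (meson iso_refl iso_Arr ty_iso)+

lemma typing_PairD: "\<Gamma> \<turnstile> Pair r s : D \<Longrightarrow> \<exists>A B. \<Gamma> \<turnstile> r : A \<and> \<Gamma> \<turnstile> s : B \<and> A \<otimes> B \<cong> D"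
  by (induction \<Gamma> "Pair r s" D rule: typing.induct) (meson iso_refl iso_trans)+

lemma typing_ProjD: "\<Gamma> \<turnstile> Proj A r : D \<Longrightarrow> (\<exists>B. \<Gamma> \<turnstile> r : A \<otimes> B) \<and> A \<cong> D"
  by (induction \<Gamma> "Proj A r" D rule: typing.induct) (meson iso_refl iso_trans)+

lemma typing_TLamD: "\<Gamma> \<turnstile> TLam r : D \<Longrightarrow> \<exists>A. map (liftT 0) \<Gamma> \<turnstile> r : A \<and> All A \<cong> D"
  by (induction \<Gamma> "TLam r" D rule: typing.induct) (meson iso_refl iso_trans)+

lemma typing_TAppD: "\<Gamma> \<turnstile> TApp r B : D \<Longrightarrow> \<exists>A. \<Gamma> \<turnstile> r : All A \<and> substT 0 B A \<cong> D"
  by (induction \<Gamma> "TApp r B" D rule: typing.induct) (meson iso_refl iso_trans)+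

text \<open>Introductions follow by congruence. Eliminations rely on normal forms:
  \<open>Arr_iso_Arr_cancel\<close> once the argument types agree, and \<open>All_iso_All\<close>
  before instantiation.\<close>

lemma typing_unique: "\<Gamma> \<turnstile> r : A \<Longrightarrow> \<Gamma> \<turnstile> r : B \<Longrightarrow> A \<cong> B"
proof (induction arbitrary: B rule: typing.induct)
  case (ty_Var i \<Gamma> A)
  then show ?case by (blast dest: typing_VarD)
next
  case (ty_iso \<Gamma> r A A')
  then show ?case by (blast intro: iso_trans iso_sym)
next
  case (ty_Lam A \<Gamma> r R)
  from typing_LamD [OF ty_Lam.prems] obtain R' where "A # \<Gamma> \<turnstile> r : R'" "A \<rightarrow> R' \<cong> B" by blast
  with ty_Lam.IH show ?case by (blast intro: iso_trans iso_Arr iso_refl)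
next
  case (ty_App \<Gamma> r A D s)
  from typing_AppD [OF ty_App.prems] obtain A' where "\<Gamma> \<turnstile> r : A' \<rightarrow> B" "\<Gamma> \<turnstile> s : A'" by blast
  with ty_App.IH show ?case by (blast intro: Arr_iso_Arr_cancel)
next
  case (ty_Pair \<Gamma> r A s A')
  from typing_PairD [OF ty_Pair.prems] obtain C C'
    where "\<Gamma> \<turnstile> r : C" "\<Gamma> \<turnstile> s : C'" "C \<otimes> C' \<cong> B" by blast
  with ty_Pair.IH show ?case by (blast intro: iso_trans iso_Conj)
next
  case (ty_Proj \<Gamma> r A A')
  then show ?case by (blast dest: typing_ProjD)
next
  case (ty_TLam \<Gamma> r A)
  from typing_TLamD [OF ty_TLam.prems] obtain A'
    where "map (liftT 0) \<Gamma> \<turnstile> r : A'" "All A' \<cong> B" by blast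
  with ty_TLam.IH show ?case by (blast intro: iso_trans iso_All)
next
  case (ty_TApp \<Gamma> r A C)
  from typing_TAppD [OF ty_TApp.prems] obtain A'
    where "\<Gamma> \<turnstile> r : All A'" "substT 0 C A' \<cong> B" by blast
  with ty_TApp.IH show ?case by (metis All_iso_All tyiso_substT iso_trans)
qed

text \<open>
  Since variables carry their types, a context typing a term at all gives it every type it has in
  any other context.
\<close>

lemma typing_transfer: "\<Gamma> \<turnstile> r : A \<Longrightarrow> \<Delta> \<turnstile> r : B \<Longrightarrow> \<Delta> \<turnstile> r : A"
proof (induction arbitrary: \<Delta> B rule: typing.induct)
  case (ty_Var i \<Gamma> A)
  then show ?case by (blast dest: typing_VarD intro: typing.ty_Var)
next
  case (ty_iso \<Gamma> r A A')
  then show ?case by (blast intro: typing.ty_iso)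
next
  case (ty_Lam A \<Gamma> r R)
  then show ?case by (blast dest: typing_LamD intro: typing.ty_Lam)
next
  case (ty_App \<Gamma> r A D s)
  then show ?case by (meson typing_AppD typing.ty_App)
next
  case (ty_Pair \<Gamma> r A s A')
  then show ?case by (meson typing_PairD typing.ty_Pair)
next
  case (ty_Proj \<Gamma> r A A')
  then show ?case by (meson typing_ProjD typing.ty_Proj)
next
  case (ty_TLam \<Gamma> r A)
  then show ?case by (meson typing_TLamD typing.ty_TLam)
next
  case (ty_TApp \<Gamma> r A C)
  then show ?case by (meson typing_TAppD typing.ty_TApp)
qed


section \<open>Weakening and substitution\<close>

text \<open>Under \<open>TLam\<close> the context is also lifted at \<open>0\<close> and the term at
  \<open>Suc k\<close>; \<open>liftT_liftT\<close> exchanges the two lifts.\<close>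

lemma typing_liftTm: "\<Gamma> \<turnstile> r : A \<Longrightarrow> map (liftT k) \<Gamma> \<turnstile> liftTm k r : liftT k A"
proof (induction arbitrary: k rule: typing.induct)
  case (ty_iso \<Gamma> r A B)
  then show ?case by (blast intro: typing.ty_iso tyiso_liftT)
next
  case (ty_TLam \<Gamma> r A)
  from ty_TLam.IH [of "Suc k"] show ?case
    by (auto simp: liftT_liftT comp_def intro!: typing.ty_TLam)
next
  case (ty_TApp \<Gamma> r A B)
  from ty_TApp.IH [of k] typing.ty_TApp [of _ _ "liftT (Suc k) A" "liftT k B"] show ?case
    by (simp add: liftT_substT_ge)
qed (auto intro: typing.ty_Var typing.ty_Lam typing.ty_App typing.ty_Pair typing.ty_Proj typing.ty_TApp)

lemma typing_substTm: "\<Gamma> \<turnstile> r : A \<Longrightarrow> map (substT k C) \<Gamma> \<turnstile> substTm k C r : substT k C A"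
proof (induction arbitrary: k C rule: typing.induct)
  case (ty_iso \<Gamma> r A B)
  then show ?case by (blast intro: typing.ty_iso tyiso_substT)
next
  case (ty_TLam \<Gamma> r A)
  from ty_TLam.IH [of "Suc k" "liftT 0 C"] show ?case
    by (auto simp: liftT_substT_le comp_def intro!: typing.ty_TLam)
next
  case (ty_TApp \<Gamma> r A B)
  from ty_TApp.IH [of k C] typing.ty_TApp [of _ _ "substT (Suc k) (liftT 0 C) A" "substT k C B"]
  show ?case by (simp add: substT_substT [of 0 k])
next
  case (ty_App \<Gamma> r A B s)
  then show ?case by (simp, blast intro: typing.ty_App)
qed (auto intro: typing.ty_Var typing.ty_Lam typing.ty_Pair typing.ty_Proj typing.ty_TApp)

text \<open>The context is split at the insertion point because each \<open>Lam\<close> extends the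
  prefix \<open>\<Delta>\<close>.\<close>

lemma typing_lift: "\<Delta> @ \<Gamma> \<turnstile> r : A \<Longrightarrow> \<Delta> @ U # \<Gamma> \<turnstile> lift (length \<Delta>) r : A"
proof (induction "\<Delta> @ \<Gamma>" r A arbitrary: \<Delta> \<Gamma> U rule: typing.induct)
  case (ty_Var i A)
  then show ?case by (auto intro!: typing.ty_Var simp: nth_append Suc_diff_le)
next
  case (ty_iso r A B)
  then show ?case by (blast intro: typing.ty_iso)
next
  case (ty_Lam A r B)
  from ty_Lam.hyps(2) [of "A # \<Delta>"] show ?case by (auto intro: typing.ty_Lam)
next
  case (ty_TLam r A)
  from ty_TLam.hyps(2) [of "map (liftT 0) \<Delta>" "map (liftT 0) \<Gamma>" "liftT 0 U"] show ?case
    by (auto intro: typing.ty_TLam)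
next
  case (ty_App r A B s)
  then show ?case by (simp, blast intro: typing.ty_App)
qed (auto intro: typing.ty_Var typing.ty_Lam typing.ty_Pair typing.ty_Proj typing.ty_TApp)

text \<open>\<open>u\<close> is generalised: crossing \<open>Lam\<close> weakens it by
  \<open>typing_lift\<close>, crossing \<open>TLam\<close> lifts its types by
  \<open>typing_liftTm\<close>.\<close>

lemma typing_subst:
  "\<Delta> @ U # \<Gamma> \<turnstile> r : A \<Longrightarrow> \<Delta> @ \<Gamma> \<turnstile> u : U \<Longrightarrow> \<Delta> @ \<Gamma> \<turnstile> subst (length \<Delta>) u r : A"
proof (induction "\<Delta> @ U # \<Gamma>" r A arbitrary: \<Delta> \<Gamma> U u rule: typing.induct)
  case (ty_Var i A)
  then show ?case
    by (auto intro!: typing.ty_Var simp: nth_append nth_Cons' split: if_splits)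
next
  case (ty_iso r A B)
  then show ?case by (blast intro: typing.ty_iso)
next
  case (ty_Lam A r B)
  from typing_lift [of "[]", simplified, OF ty_Lam.prems] ty_Lam.hyps(2) [of "A # \<Delta>"]
  show ?case by (auto intro: typing.ty_Lam)
next
  case (ty_TLam r A)
  from typing_liftTm [OF ty_TLam.prems, of 0]
    ty_TLam.hyps(2) [of "map (liftT 0) \<Delta>" "liftT 0 U" "map (liftT 0) \<Gamma>"]
  show ?case by (auto intro: typing.ty_TLam)
next
  case (ty_App r A B s)
  then show ?case by (simp, blast intro: typing.ty_App)
next
  case (ty_Proj r A B)
  then show ?case by (simp, blast intro: typing.ty_Proj)
qed (auto intro: typing.ty_Var typing.ty_Lam typing.ty_Pair typing.ty_Proj typing.ty_TApp)


section \<open>Subject reduction\<close>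

text \<open>Stating an equivalence makes the symmetry rule immediate. Each generator is inverted,
  its type rearranged by the corresponding isomorphism, and the other side retyped.\<close>

lemma typing_eqv: "r \<rightleftharpoons> s \<Longrightarrow> \<Gamma> \<turnstile> r : A \<longleftrightarrow> \<Gamma> \<turnstile> s : A"
proof (induction arbitrary: \<Gamma> A rule: eqv.induct)
  case (eqv_comm r s)
  have "\<Gamma> \<turnstile> Pair s r : A" if "\<Gamma> \<turnstile> Pair r s : A" for r s
    using that by (meson typing_PairD ty_Pair ty_iso iso_comm)
  then show ?case by blast
next
  case (eqv_assoc r s t)
  show ?case
  proof
    assume "\<Gamma> \<turnstile> Pair r (Pair s t) : A"
    then obtain R S T M where *: "\<Gamma> \<turnstile> r : R" "\<Gamma> \<turnstile> s : S" "\<Gamma> \<turnstile> t : T" "S \<otimes> T \<cong> M" "R \<otimes> M \<cong> A"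
      by (meson typing_PairD)
    then have "R \<otimes> (S \<otimes> T) \<cong> A" by (meson iso_Conj iso_refl iso_trans)
    then have "(R \<otimes> S) \<otimes> T \<cong> A" by (meson iso_assoc iso_sym iso_trans)
    with * show "\<Gamma> \<turnstile> Pair (Pair r s) t : A" by (meson ty_Pair ty_iso)
  next
    assume "\<Gamma> \<turnstile> Pair (Pair r s) t : A"
    then obtain R S T M where *: "\<Gamma> \<turnstile> r : R" "\<Gamma> \<turnstile> s : S" "\<Gamma> \<turnstile> t : T" "R \<otimes> S \<cong> M" "M \<otimes> T \<cong> A"
      by (meson typing_PairD)
    then have "(R \<otimes> S) \<otimes> T \<cong> A" by (meson iso_Conj iso_refl iso_trans)
    then have "R \<otimes> (S \<otimes> T) \<cong> A" by (meson iso_assoc iso_trans)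
    with * show "\<Gamma> \<turnstile> Pair r (Pair s t) : A" by (meson ty_Pair ty_iso)
  qed
next
  case (eqv_Lam_Pair U r s)
  show ?case
  proof
    assume "\<Gamma> \<turnstile> Lam U (Pair r s) : A"
    then obtain M R S where *: "U \<rightarrow> M \<cong> A" "U # \<Gamma> \<turnstile> r : R" "U # \<Gamma> \<turnstile> s : S" "R \<otimes> S \<cong> M"
      by (meson typing_LamD typing_PairD)
    then have "U \<rightarrow> (R \<otimes> S) \<cong> A" by (meson iso_Arr iso_refl iso_trans)
    then have "(U \<rightarrow> R) \<otimes> (U \<rightarrow> S) \<cong> A" by (meson iso_dist iso_sym iso_trans)
    with * show "\<Gamma> \<turnstile> Pair (Lam U r) (Lam U s) : A" by (meson ty_Pair ty_Lam ty_iso)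
  next
    assume "\<Gamma> \<turnstile> Pair (Lam U r) (Lam U s) : A"
    then obtain R S R' S' where *: "U # \<Gamma> \<turnstile> r : R" "U \<rightarrow> R \<cong> R'" "U # \<Gamma> \<turnstile> s : S" "U \<rightarrow> S \<cong> S'"
        "R' \<otimes> S' \<cong> A"
      by (meson typing_LamD typing_PairD)
    then have "(U \<rightarrow> R) \<otimes> (U \<rightarrow> S) \<cong> A" by (meson iso_Conj iso_trans)
    then have "U \<rightarrow> (R \<otimes> S) \<cong> A" by (meson iso_dist iso_trans)
    with * show "\<Gamma> \<turnstile> Lam U (Pair r s) : A" by (meson ty_Pair ty_Lam ty_iso)
  qed
next
  case (eqv_App_Pair r s t)
  show ?case
  proof
    assume "\<Gamma> \<turnstile> App (Pair r s) t : A"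
    then obtain T R S where *: "\<Gamma> \<turnstile> t : T" "\<Gamma> \<turnstile> r : R" "\<Gamma> \<turnstile> s : S" "R \<otimes> S \<cong> T \<rightarrow> A"
      by (meson typing_AppD typing_PairD)
    \<comment> \<open>The conjunction typing the pair must also be an arrow type, so both components
      are arrows from \<open>T\<close>.\<close>
    from *(4) obtain A1 A2 where "R \<cong> T \<rightarrow> A1" "S \<cong> T \<rightarrow> A2" "A \<cong> A1 \<otimes> A2"
      by (rule Conj_iso_Arr)
    with * show "\<Gamma> \<turnstile> Pair (App r t) (App s t) : A" by (meson iso_sym ty_App ty_Pair ty_iso)
  next
    assume "\<Gamma> \<turnstile> Pair (App r t) (App s t) : A"
    then obtain T T' R S where *: "\<Gamma> \<turnstile> t : T" "\<Gamma> \<turnstile> t : T'" "\<Gamma> \<turnstile> r : T \<rightarrow> R" "\<Gamma> \<turnstile> s : T' \<rightarrow> S"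
        "R \<otimes> S \<cong> A"
      by (meson typing_AppD typing_PairD)
    \<comment> \<open>The two copies of \<open>t\<close> may have been typed differently; uniqueness
      reconciles their types.\<close>
    then have "T' \<cong> T" by (blast intro: typing_unique)
    with *(4) have "\<Gamma> \<turnstile> s : T \<rightarrow> S" by (meson iso_Arr iso_refl ty_iso)
    with *(3) have "\<Gamma> \<turnstile> Pair r s : T \<rightarrow> (R \<otimes> S)" by (meson iso_dist iso_sym ty_Pair ty_iso)
    with * show "\<Gamma> \<turnstile> App (Pair r s) t : A" by (meson ty_App ty_iso)
  qed
next
  case (eqv_curry r s t)
  show ?case
  proof
    assume "\<Gamma> \<turnstile> App r (Pair s t) : A"
    then obtain M S T where *: "\<Gamma> \<turnstile> r : M \<rightarrow> A" "\<Gamma> \<turnstile> s : S" "\<Gamma> \<turnstile> t : T" "S \<otimes> T \<cong> M"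
      by (meson typing_AppD typing_PairD)
    then have "\<Gamma> \<turnstile> r : (S \<otimes> T) \<rightarrow> A" by (meson iso_Arr iso_refl iso_sym ty_iso)
    then have "\<Gamma> \<turnstile> r : S \<rightarrow> T \<rightarrow> A" by (meson iso_curry ty_iso)
    with * show "\<Gamma> \<turnstile> App (App r s) t : A" by (meson ty_App)
  next
    assume "\<Gamma> \<turnstile> App (App r s) t : A"
    then obtain S T where *: "\<Gamma> \<turnstile> r : S \<rightarrow> T \<rightarrow> A" "\<Gamma> \<turnstile> s : S" "\<Gamma> \<turnstile> t : T"
      by (meson typing_AppD)
    then have "\<Gamma> \<turnstile> r : (S \<otimes> T) \<rightarrow> A" by (meson iso_curry iso_sym ty_iso)
    with * show "\<Gamma> \<turnstile> App r (Pair s t) : A" by (meson ty_App ty_Pair)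
  qed
next
  case (eqv_TLam_Lam U r)
  show ?case
  proof
    assume "\<Gamma> \<turnstile> TLam (Lam (liftT 0 U) r) : A"
    then obtain M R where *: "All M \<cong> A" "map (liftT 0) (U # \<Gamma>) \<turnstile> r : R" "liftT 0 U \<rightarrow> R \<cong> M"
      by (metis typing_TLamD typing_LamD list.map(2))
    then have "U \<rightarrow> All R \<cong> A" by (meson iso_All iso_all_arr iso_sym iso_trans)
    with * show "\<Gamma> \<turnstile> Lam U (TLam r) : A" by (meson ty_TLam ty_Lam ty_iso)
  next
    assume "\<Gamma> \<turnstile> Lam U (TLam r) : A"
    then obtain M R where *: "U \<rightarrow> M \<cong> A" "liftT 0 U # map (liftT 0) \<Gamma> \<turnstile> r : R" "All R \<cong> M"
      by (metis typing_TLamD typing_LamD list.map(2))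
    then have "All (liftT 0 U \<rightarrow> R) \<cong> A" by (meson iso_Arr iso_all_arr iso_refl iso_trans)
    with * show "\<Gamma> \<turnstile> TLam (Lam (liftT 0 U) r) : A" by (meson ty_TLam ty_Lam ty_iso)
  qed
next
  case (eqv_TApp_Lam U r B)
  show ?case
  proof
    assume "\<Gamma> \<turnstile> TApp (Lam U r) B : A"
    then obtain C R where *: "substT 0 B C \<cong> A" "U # \<Gamma> \<turnstile> r : R" "U \<rightarrow> R \<cong> All C"
      by (meson typing_TAppD typing_LamD)
    \<comment> \<open>An abstraction of quantified type has a quantified body. Instantiating then
      leaves the domain intact, as \<open>substT 0 B\<close> cancels \<open>liftT 0\<close>.\<close>
    from *(3) obtain R' where R': "R \<cong> All R'" "C \<cong> liftT 0 U \<rightarrow> R'" by (rule Arr_iso_All)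
    from tyiso_substT [OF R'(2), of 0 B] have "U \<rightarrow> substT 0 B R' \<cong> substT 0 B C"
      by (simp add: iso_sym)
    with * R' show "\<Gamma> \<turnstile> Lam U (TApp r B) : A" by (meson iso_trans ty_TApp ty_Lam ty_iso)
  next
    assume "\<Gamma> \<turnstile> Lam U (TApp r B) : A"
    then obtain M R where *: "U \<rightarrow> M \<cong> A" "U # \<Gamma> \<turnstile> r : All R" "substT 0 B R \<cong> M"
      by (meson typing_TAppD typing_LamD)
    then have "\<Gamma> \<turnstile> Lam U r : All (liftT 0 U \<rightarrow> R)" by (meson iso_all_arr iso_sym ty_Lam ty_iso)
    from ty_TApp [OF this, of B] have "\<Gamma> \<turnstile> TApp (Lam U r) B : U \<rightarrow> substT 0 B R" by simp
    with * show "\<Gamma> \<turnstile> TApp (Lam U r) B : A" by (meson iso_Arr iso_refl iso_trans ty_iso)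
  qed
next
  case (eqv_TLam_Pair r s)
  show ?case
  proof
    assume "\<Gamma> \<turnstile> TLam (Pair r s) : A"
    then obtain M R S where *: "All M \<cong> A" "map (liftT 0) \<Gamma> \<turnstile> r : R" "map (liftT 0) \<Gamma> \<turnstile> s : S"
        "R \<otimes> S \<cong> M"
      by (meson typing_TLamD typing_PairD)
    then have "All R \<otimes> All S \<cong> A" by (meson iso_All iso_all_conj iso_sym iso_trans)
    with * show "\<Gamma> \<turnstile> Pair (TLam r) (TLam s) : A" by (meson ty_TLam ty_Pair ty_iso)
  next
    assume "\<Gamma> \<turnstile> Pair (TLam r) (TLam s) : A"
    then obtain R S R' S' where *: "map (liftT 0) \<Gamma> \<turnstile> r : R" "All R \<cong> R'"
        "map (liftT 0) \<Gamma> \<turnstile> s : S" "All S \<cong> S'" "R' \<otimes> S' \<cong> A"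
      by (meson typing_TLamD typing_PairD)
    then have "All R \<otimes> All S \<cong> A" by (meson iso_Conj iso_trans)
    then have "All (R \<otimes> S) \<cong> A" by (meson iso_all_conj iso_trans)
    with * show "\<Gamma> \<turnstile> TLam (Pair r s) : A" by (meson ty_TLam ty_Pair ty_iso)
  qed
next
  case (eqv_TApp_Pair r s B)
  show ?case
  proof
    assume "\<Gamma> \<turnstile> TApp (Pair r s) B : A"
    then obtain C R S where *: "substT 0 B C \<cong> A" "\<Gamma> \<turnstile> r : R" "\<Gamma> \<turnstile> s : S" "R \<otimes> S \<cong> All C"
      by (meson typing_TAppD typing_PairD)
    from *(4) obtain C1 C2 where C: "R \<cong> All C1" "S \<cong> All C2" "C \<cong> C1 \<otimes> C2" by (rule Conj_iso_All)
    from tyiso_substT [OF C(3), of 0 B] have "substT 0 B C1 \<otimes> substT 0 B C2 \<cong> substT 0 B C"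
      by (simp add: iso_sym)
    with * C show "\<Gamma> \<turnstile> Pair (TApp r B) (TApp s B) : A"
      by (meson iso_trans ty_TApp ty_Pair ty_iso)
  next
    assume "\<Gamma> \<turnstile> Pair (TApp r B) (TApp s B) : A"
    then obtain R S R' S' where *: "\<Gamma> \<turnstile> r : All R" "\<Gamma> \<turnstile> s : All S" "substT 0 B R \<cong> R'"
        "substT 0 B S \<cong> S'" "R' \<otimes> S' \<cong> A"
      by (meson typing_TAppD typing_PairD)
    then have "\<Gamma> \<turnstile> Pair r s : All (R \<otimes> S)" by (meson iso_all_conj iso_sym ty_Pair ty_iso)
    from ty_TApp [OF this, of B] have "\<Gamma> \<turnstile> TApp (Pair r s) B : substT 0 B R \<otimes> substT 0 B S" by simp
    with * show "\<Gamma> \<turnstile> TApp (Pair r s) B : A" by (meson iso_Conj iso_trans ty_iso)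
  qed
next
  case (eqv_Proj_TLam U r)
  show ?case
  proof
    assume "\<Gamma> \<turnstile> Proj (All U) (TLam r) : A"
    then obtain M R where *: "All U \<cong> A" "map (liftT 0) \<Gamma> \<turnstile> r : R" "All R \<cong> All U \<otimes> M"
      by (meson typing_ProjD typing_TLamD)
    \<comment> \<open>Splitting \<open>R\<close> yields a conjunct \<open>R1\<close>, which
      \<open>All_iso_All\<close> identifies with \<open>U\<close>.\<close>
    from iso_sym [OF *(3)] obtain R1 R2 where "All U \<cong> All R1" "R \<cong> R1 \<otimes> R2" by (rule Conj_iso_All)
    then have "R \<cong> U \<otimes> R2" by (meson All_iso_All iso_Conj iso_refl iso_sym iso_trans)
    with * show "\<Gamma> \<turnstile> TLam (Proj U r) : A" by (meson ty_TLam ty_Proj ty_iso)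
  next
    assume "\<Gamma> \<turnstile> TLam (Proj U r) : A"
    then obtain M R where *: "All M \<cong> A" "U \<cong> M" "map (liftT 0) \<Gamma> \<turnstile> r : U \<otimes> R"
      by (meson typing_ProjD typing_TLamD)
    then have "\<Gamma> \<turnstile> TLam r : All U \<otimes> All R" by (meson iso_all_conj ty_TLam ty_iso)
    with * show "\<Gamma> \<turnstile> Proj (All U) (TLam r) : A" by (meson iso_All ty_Proj ty_iso)
  qed
next
  case (eqv_Proj_TApp \<Delta> r B C U)
  show ?case
  proof
    assume "\<Gamma> \<turnstile> TApp (Proj (All B) r) U : A"
    then obtain D M where *: "substT 0 U D \<cong> A" "All B \<cong> All D" "\<Gamma> \<turnstile> r : M"
      by (meson typing_TAppD typing_ProjD)
    then have A: "substT 0 U B \<cong> A" by (meson All_iso_All tyiso_substT iso_trans)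
    \<comment> \<open>Inverting the projection leaves the second conjunct arbitrary. The side
      condition, carried from \<open>\<Delta>\<close> to \<open>\<Gamma>\<close>, makes it
      quantified too, so that \<open>r\<close> can be instantiated.\<close>
    have "\<Gamma> \<turnstile> r : All (B \<otimes> C)" using eqv_Proj_TApp *(3) by (rule typing_transfer)
    from ty_TApp [OF this, of U] have "\<Gamma> \<turnstile> TApp r U : substT 0 U B \<otimes> substT 0 U C" by simp
    with A show "\<Gamma> \<turnstile> Proj (substT 0 U B) (TApp r U) : A" by (meson ty_Proj ty_iso)
  next
    assume "\<Gamma> \<turnstile> Proj (substT 0 U B) (TApp r U) : A"
    then obtain M where *: "substT 0 U B \<cong> A" "\<Gamma> \<turnstile> r : M"
      by (meson typing_TAppD typing_ProjD)
    \<comment> \<open>An instance of a quantified type does not determine its body, so the conjunct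
      \<open>B\<close> is again taken from the side condition.\<close>
    have "\<Gamma> \<turnstile> r : All (B \<otimes> C)" using eqv_Proj_TApp *(2) by (rule typing_transfer)
    then have "\<Gamma> \<turnstile> r : All B \<otimes> All C" by (meson iso_all_conj ty_iso)
    with * show "\<Gamma> \<turnstile> TApp (Proj (All B) r) U : A" by (meson ty_Proj ty_TApp ty_iso)
  qed
next
  case (eqv_Lam r s A)
  then show ?case by (meson typing_LamD ty_Lam ty_iso)
next
  case (eqv_App1 r s t)
  then show ?case by (meson typing_AppD ty_App)
next
  case (eqv_App2 r s t)
  then show ?case by (meson typing_AppD ty_App)
next
  case (eqv_Pair1 r s t)
  then show ?case by (meson typing_PairD ty_Pair ty_iso)
next
  case (eqv_Pair2 r s t)
  then show ?case by (meson typing_PairD ty_Pair ty_iso)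
next
  case (eqv_Proj r s U)
  then show ?case by (meson typing_ProjD ty_Proj ty_iso)
next
  case (eqv_TLam r s)
  then show ?case by (meson typing_TLamD ty_TLam ty_iso)
next
  case (eqv_TApp r s U)
  then show ?case by (meson typing_TAppD ty_TApp ty_iso)
qed simp_all

lemma typing_red: "r \<hookrightarrow> s \<Longrightarrow> \<Gamma> \<turnstile> r : A \<Longrightarrow> \<Gamma> \<turnstile> s : A"
proof (induction arbitrary: \<Gamma> A rule: red.induct)
  case (red_beta \<Delta> s U r)
  then obtain M R where *: "\<Gamma> \<turnstile> s : M" "U # \<Gamma> \<turnstile> r : R" "U \<rightarrow> R \<cong> M \<rightarrow> A"
    by (meson typing_AppD typing_LamD)
  \<comment> \<open>Isomorphic arrow types need not have isomorphic domains, so inversion does not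
    relate \<open>M\<close> to \<open>U\<close>; the side condition, moved to
    \<open>\<Gamma>\<close>, does.\<close>
  have s: "\<Gamma> \<turnstile> s : U" using red_beta.hyps *(1) by (rule typing_transfer)
  then have "R \<cong> A" using * by (meson typing_unique Arr_iso_Arr_cancel)
  moreover have "\<Gamma> \<turnstile> subst 0 s r : R" using typing_subst [of "[]"] *(2) s by simp
  ultimately show ?case by (meson ty_iso)
next
  case (red_Beta r U)
  then obtain C R where *: "substT 0 U C \<cong> A" "map (liftT 0) \<Gamma> \<turnstile> r : R" "All R \<cong> All C"
    by (meson typing_TAppD typing_TLamD)
  \<comment> \<open>\<open>substT 0 U\<close> undoes the lifting of the context, which brings the
    typing back to \<open>\<Gamma>\<close>.\<close>
  from typing_substTm [OF *(2), of 0 U] have "\<Gamma> \<turnstile> substTm 0 U r : substT 0 U R"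
    by (simp add: comp_def)
  with * show ?case by (meson All_iso_All tyiso_substT ty_iso)
next
  case (red_pi \<Delta> r U s)
  then obtain R where "U \<cong> A" "\<Gamma> \<turnstile> r : R" by (meson typing_ProjD typing_PairD)
  \<comment> \<open>A pair of type \<open>U \<otimes> B\<close> need not have a first component of
    type \<open>U\<close>, as conjunction is commutative; the transferred side condition ensures
    it.\<close>
  with red_pi.hyps show ?case by (meson typing_transfer ty_iso)
next
  case (red_Lam r s A)
  then show ?case by (meson typing_LamD ty_Lam ty_iso)
next
  case (red_App1 r s t)
  then show ?case by (meson typing_AppD ty_App)
next
  case (red_App2 r s t)
  then show ?case by (meson typing_AppD ty_App)
next
  case (red_Pair1 r s t)
  then show ?case by (meson typing_PairD ty_Pair ty_iso)
next
  case (red_Pair2 r s t)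
  then show ?case by (meson typing_PairD ty_Pair ty_iso)
next
  case (red_Proj r s U)
  then show ?case by (meson typing_ProjD ty_Proj ty_iso)
next
  case (red_TLam r s)
  then show ?case by (meson typing_TLamD ty_TLam ty_iso)
next
  case (red_TApp r s U)
  then show ?case by (meson typing_TAppD ty_TApp ty_iso)
qed

theorem mainTheorem1:
  fixes \<Gamma> :: "ty list" and r s :: tm and A :: ty
  assumes "\<Gamma> \<turnstile> r : A" and "r \<hookrightarrow> s \<or> r \<rightleftharpoons> s"
  shows "\<Gamma> \<turnstile> s : A"
  using assms by (blast dest: typing_red typing_eqv)

end
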